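(* Consider a fluid timed Petri net with no priority rules, and suppose that it admits a positive stoichiometric invariant $e$. Then the dynamics of the timed Petri net is equivalent to the dynamic programming equation of an undiscounted semi-Markov decision process.
   Context: A fluid timed Petri net without priority rules consists of: two finite disjoint sets $\mathcal{P}$ (places) and $\mathcal{Q}$ (transitions); a directed bipartite graph on $\mathcal{P}\cup\mathcal{Q}$, where $x^{\mathrm{in}}$ (resp. $x^{\mathrm{out}}$) denotes the set of vertices $y$ with an arc from $y$ to $x$ (resp. from $x$ to $y$); an initial marking $m_p\ge 0$ and a holding time $\tau_p\ge 0$ for each place $p$; a weight $\alpha_{qp}>0$ for each arc from place $p$ to transition $q$, and a weight $\alpha_{pq}>0$ for each arc from transition $q$ to place $p$. Each place with several downstream transitions is ruled by (proportional) preselection: for a place $p$ ruled by preselection, a probability vector $(\pi_{qp})_{q\in p^{\mathrm{out}}}$ is given, and every $q\in p^{\mathrm{out}}$ has $p$ as its only upstream place. For a transition $q$ none of whose upstream places is ruled by preselection, one sets $\pi_{qp}=1$ for all $p\in q^{\mathrm{in}}$. The dynamics of the net is the system governing the counter functions $z_q$ ($z_q(t)$ is the number of firings of transition $q$ up to time $t$): $$z_q(t)=\min_{p\in q^{\mathrm{in}}}\ \pi_{qp}\,\alpha_{qp}^{-1}\Big(m_p+\sum_{q'\in p^{\mathrm{in}}}\alpha_{pq'}\,z_{q'}(t-\tau_p)\Big),\qquad q\in\mathcal{Q}.$$ A stoichiometric invariant is a vector $e=(e_q)_{q\in\mathcal{Q}}$ such that for all $q\in\mathcal{Q}$ and all $p\in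 q^{\mathrm{in}}$, $e_q=\pi_{qp}\alpha_{qp}^{-1}\sum_{q'\in p^{\mathrm{in}}}\alpha_{pq'}e_{q'}$. It is positive if $e_q>0$ for all $q$. A semi-Markov decision process has a finite state set $S$, finite action sets $A_i$ ($i\in S$), and, for each $i\in S$ and $a\in A_i$, a cost $r_i^a$, a holding time $t_i^a\ge0$, a discount factor $\gamma_i^a\ge 0$ and transition probabilities $(P^a_{ij})_{j\in S}$ with $\sum_{j\in S}P^a_{ij}=1$. Its (finite horizon) dynamic programming equation is $$v(i,t)=\inf_{a\in A_i}\Big\{r_i^a+\gamma_i^a\sum_{j\in S}P_{ij}^a\, v(j,t-t_i^a)\Big\}.$$ The process is undiscounted if $\gamma_i^a=1$ for all $i\in S$ and $a\in A_i$. *)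

theory Defs
  imports Complex_Main
begin

text \<open>
  Places and transitions live in two different types, so the two vertex sets are disjoint and the
  graph is bipartite by construction.  Following the mathematical index order,
  \<open>wt_pt N q p\<close> is the weight \<open>\<alpha>\<^sub>q\<^sub>p\<close> of the arc from place \<open>p\<close> to transition \<open>q\<close>,
  \<open>wt_tp N p q\<close> is the weight \<open>\<alpha>\<^sub>p\<^sub>q\<close> of the arc from transition \<open>q\<close> to place \<open>p\<close>,
  and \<open>route N q p\<close> is \<open>\<pi>\<^sub>q\<^sub>p\<close>.
\<close>

record ('p, 'q) petri_net =
  places :: "'p set"
  transitions :: "'q set"
  arcs_pt :: "('p \<times> 'q) set"
  arcs_tp :: "('q \<times> 'p) set"
  marking :: "'p \<Rightarrow> real"
  holding :: "'p \<Rightarrow> real"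
  wt_pt :: "'q \<Rightarrow> 'p \<Rightarrow> real"
  wt_tp :: "'p \<Rightarrow> 'q \<Rightarrow> real"
  preselection :: "'p set"
  route :: "'q \<Rightarrow> 'p \<Rightarrow> real"

definition trans_in :: "('p, 'q) petri_net \<Rightarrow> 'q \<Rightarrow> 'p set" where
  "trans_in N q = {p. (p, q) \<in> arcs_pt N}"

definition place_out :: "('p, 'q) petri_net \<Rightarrow> 'p \<Rightarrow> 'q set" where
  "place_out N p = {q. (p, q) \<in> arcs_pt N}"

definition place_in :: "('p, 'q) petri_net \<Rightarrow> 'p \<Rightarrow> 'q set" where
  "place_in N p = {q. (q, p) \<in> arcs_tp N}"

text \<open>
  Absence of priority rules: every place with at least two downstream transitions is ruled by
  preselection.  The condition \<open>trans_in_nonempty\<close> is what makes the minimum in the dynamics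
  meaningful.
\<close>

locale fluid_petri_net =
  fixes N :: "('p, 'q) petri_net"
  assumes finite_places: "finite (places N)"
    and finite_transitions: "finite (transitions N)"
    and arcs_pt: "arcs_pt N \<subseteq> places N \<times> transitions N"
    and arcs_tp: "arcs_tp N \<subseteq> transitions N \<times> places N"
    and trans_in_nonempty: "q \<in> transitions N \<Longrightarrow> trans_in N q \<noteq> {}"
    and marking_nonneg: "p \<in> places N \<Longrightarrow> 0 \<le> marking N p"
    and holding_nonneg: "p \<in> places N \<Longrightarrow> 0 \<le> holding N p"
    and wt_pt_pos: "(p, q) \<in> arcs_pt N \<Longrightarrow> 0 < wt_pt N q p"
    and wt_tp_pos: "(q, p) \<in> arcs_tp N \<Longrightarrow> 0 < wt_tp N p q"
    and preselection_subset: "preselection N \<subseteq> places N"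
    and no_priority: "p \<in> places N \<Longrightarrow> 2 \<le> card (place_out N p) \<Longrightarrow> p \<in> preselection N"
    and preselection_unique_in:
      "p \<in> preselection N \<Longrightarrow> q \<in> place_out N p \<Longrightarrow> trans_in N q = {p}"
    and route_nonneg: "p \<in> preselection N \<Longrightarrow> q \<in> place_out N p \<Longrightarrow> 0 \<le> route N q p"
    and route_sum: "p \<in> preselection N \<Longrightarrow> (\<Sum>q\<in>place_out N p. route N q p) = 1"
    and route_synchronization:
      "q \<in> transitions N \<Longrightarrow> trans_in N q \<inter> preselection N = {} \<Longrightarrow> p \<in> trans_in N q
        \<Longrightarrow> route N q p = 1"

text \<open>
  Here \<open>T\<close> is the set of times at which the equations are required to hold: \<open>UNIV\<close> for all of
  them, \<open>{0..}\<close> if \<open>z\<close> is an arbitrary initial condition at negative times.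
\<close>

definition petri_dynamics ::
  "('p, 'q) petri_net \<Rightarrow> real set \<Rightarrow> ('q \<Rightarrow> real \<Rightarrow> real) \<Rightarrow> bool" where
  "petri_dynamics N T z \<longleftrightarrow>
    (\<forall>q\<in>transitions N. \<forall>t\<in>T.
      z q t = (MIN p\<in>trans_in N q.
        route N q p * inverse (wt_pt N q p) *
        (marking N p + (\<Sum>q'\<in>place_in N p. wt_tp N p q' * z q' (t - holding N p)))))"

definition stoichiometric_invariant :: "('p, 'q) petri_net \<Rightarrow> ('q \<Rightarrow> real) \<Rightarrow> bool" where
  "stoichiometric_invariant N e \<longleftrightarrow>
    (\<forall>q\<in>transitions N. \<forall>p\<in>trans_in N q.
      e q = route N q p * inverse (wt_pt N q p) * (\<Sum>q'\<in>place_in N p. wt_tp N p q' * e q'))"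

definition positive_stoichiometric_invariant :: "('p, 'q) petri_net \<Rightarrow> ('q \<Rightarrow> real) \<Rightarrow> bool" where
  "positive_stoichiometric_invariant N e \<longleftrightarrow>
    stoichiometric_invariant N e \<and> (\<forall>q\<in>transitions N. 0 < e q)"

record ('s, 'a) decision_process =
  states :: "'s set"
  actions :: "'s \<Rightarrow> 'a set"
  cost :: "'s \<Rightarrow> 'a \<Rightarrow> real"
  sojourn :: "'s \<Rightarrow> 'a \<Rightarrow> real"
  discount :: "'s \<Rightarrow> 'a \<Rightarrow> real"
  transition_prob :: "'s \<Rightarrow> 'a \<Rightarrow> 's \<Rightarrow> real"

locale semi_markov_decision_process =
  fixes D :: "('s, 'a) decision_process"
  assumes finite_states: "finite (states D)"
    and finite_actions: "i \<in> states D \<Longrightarrow> finite (actions D i)"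
    and actions_nonempty: "i \<in> states D \<Longrightarrow> actions D i \<noteq> {}"
    and sojourn_nonneg: "i \<in> states D \<Longrightarrow> a \<in> actions D i \<Longrightarrow> 0 \<le> sojourn D i a"
    and discount_nonneg: "i \<in> states D \<Longrightarrow> a \<in> actions D i \<Longrightarrow> 0 \<le> discount D i a"
    and prob_nonneg:
      "i \<in> states D \<Longrightarrow> a \<in> actions D i \<Longrightarrow> j \<in> states D \<Longrightarrow> 0 \<le> transition_prob D i a j"
    and prob_sum:
      "i \<in> states D \<Longrightarrow> a \<in> actions D i \<Longrightarrow> (\<Sum>j\<in>states D. transition_prob D i a j) = 1"

definition undiscounted :: "('s, 'a) decision_process \<Rightarrow> bool" where
  "undiscounted D \<longleftrightarrow> (\<forall>i\<in>states D. \<forall>a\<in>actions D i. discount D i a = 1)"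

definition dp_equation ::
  "('s, 'a) decision_process \<Rightarrow> real set \<Rightarrow> ('s \<Rightarrow> real \<Rightarrow> real) \<Rightarrow> bool" where
  "dp_equation D T v \<longleftrightarrow>
    (\<forall>i\<in>states D. \<forall>t\<in>T.
      v i t = (INF a\<in>actions D i.
        cost D i a +
        discount D i a * (\<Sum>j\<in>states D. transition_prob D i a j * v j (t - sojourn D i a))))"

text \<open>
  Equivalence of the two systems of equations: the states of the decision process are the
  transitions of the net, and the positive diagonal change of variables
  \<open>z\<^sub>q(t) = e\<^sub>q v(q, t)\<close> exchanges their solutions, whatever the set \<open>T\<close> of times at which the
  equations are imposed.
\<close>

definition equivalent_dynamics ::
  "('q \<Rightarrow> real) \<Rightarrow> ('p, 'q) petri_net \<Rightarrow> ('q, 'a) decision_process \<Rightarrow> bool" where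
  "equivalent_dynamics e N D \<longleftrightarrow>
    states D = transitions N \<and>
    (\<forall>q\<in>transitions N. 0 < e q) \<and>
    (\<forall>T z v. (\<forall>q\<in>transitions N. \<forall>t. z q t = e q * v q t) \<longrightarrow>
      (petri_dynamics N T z \<longleftrightarrow> dp_equation D T v))"

end

theory Submission
  imports Defs
begin

text \<open>
  Substitute \<open>z\<^sub>q(t) = e\<^sub>q v(q, t)\<close> in the dynamics of the net and divide the equation of \<open>q\<close> by
  \<open>e\<^sub>q > 0\<close>; division by a positive number passes through the minimum.  In the term of the upstream
  place \<open>p\<close>, the value \<open>v(q', t - \<tau>\<^sub>p)\<close> then carries the coefficient
  \<open>\<pi>\<^sub>q\<^sub>p \<alpha>\<^sub>q\<^sub>p\<^sup>-\<^sup>1 \<alpha>\<^sub>p\<^sub>q\<^sub>' e\<^sub>q\<^sub>' / e\<^sub>q\<close>, and the equation saying that \<open>e\<close> is a stoichiometric invariant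
  is precisely the statement that these coefficients sum to one over \<open>q'\<close> (\<open>rescaled_prob_sum\<close>).
  They are thus the transition probabilities of a decision process whose states are the transitions
  of the net, whose actions in state \<open>q\<close> are the upstream places of \<open>q\<close>, whose sojourn times are the
  holding times and whose discount factors all equal one.  The marking contributes the cost
  \<open>\<pi>\<^sub>q\<^sub>p \<alpha>\<^sub>q\<^sub>p\<^sup>-\<^sup>1 m\<^sub>p / e\<^sub>q\<close>.  As every step of the computation is reversible, the two systems have the
  same solutions up to the change of variables.
\<close>

definition rescaled_process ::
  "('p, 'q) petri_net \<Rightarrow> ('q \<Rightarrow> real) \<Rightarrow> ('q, 'p) decision_process" where
  "rescaled_process N e =
    \<lparr>states = transitions N,
     actions = trans_in N,
     cost = (\<lambda>q p. route N q p * inverse (wt_pt N q p) * marking N p / e q),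
     sojourn = (\<lambda>q p. holding N p),
     discount = (\<lambda>q p. 1),
     transition_prob = (\<lambda>q p q'. if q' \<in> place_in N p
       then route N q p * inverse (wt_pt N q p) * wt_tp N p q' * e q' / e q else 0)\<rparr>"

lemma Min_mult_left:
  fixes c :: real
  assumes "finite A" "A \<noteq> {}" "0 \<le> c"
  shows "(MIN x\<in>A. c * f x) = c * (MIN x\<in>A. f x)"
proof -
  have "mono ((*) c)"
    using assms(3) by (auto intro: monoI mult_left_mono)
  from mono_Min_commute[OF this, of "f ` A"] show ?thesis
    using assms(1,2) by (simp add: image_image)
qed

context fluid_petri_net
begin

lemma trans_in_subset: "trans_in N q \<subseteq> places N"
  using arcs_pt by (auto simp: trans_in_def)

lemma finite_trans_in: "finite (trans_in N q)"
  using finite_subset[OF trans_in_subset finite_places] .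

lemma place_in_subset: "place_in N p \<subseteq> transitions N"
  using arcs_tp by (auto simp: place_in_def)

text \<open>
  The sum on the right of the invariant equation is nonnegative, while its left-hand side is
  positive, which forces the sign of the factor in front of the sum.
\<close>

lemma positive_invariant_coeff_pos:
  assumes e: "positive_stoichiometric_invariant N e"
    and q: "q \<in> transitions N" and p: "p \<in> trans_in N q"
  shows "0 < route N q p * inverse (wt_pt N q p)"
proof -
  let ?S = "\<Sum>q'\<in>place_in N p. wt_tp N p q' * e q'"
  have "0 \<le> ?S"
  proof (rule sum_nonneg)
    fix q' assume q': "q' \<in> place_in N p"
    then have "0 < wt_tp N p q'" by (simp add: place_in_def wt_tp_pos)
    moreover have "0 < e q'"
      using e q' place_in_subset by (auto simp: positive_stoichiometric_invariant_def)
    ultimately show "0 \<le> wt_tp N p q' * e q'" by simp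
  qed
  moreover have "0 < route N q p * inverse (wt_pt N q p) * ?S"
    using e q p unfolding positive_stoichiometric_invariant_def stoichiometric_invariant_def
    by metis
  ultimately show ?thesis
    by (meson not_less mult_nonpos_nonneg)
qed

lemma rescaled_expectation:
  "(\<Sum>q'\<in>transitions N. transition_prob (rescaled_process N e) q p q' * w q') =
    route N q p * inverse (wt_pt N q p) * (\<Sum>q'\<in>place_in N p. wt_tp N p q' * (e q' * w q')) / e q"
proof -
  have "(\<Sum>q'\<in>transitions N. transition_prob (rescaled_process N e) q p q' * w q') =
      (\<Sum>q'\<in>place_in N p. transition_prob (rescaled_process N e) q p q' * w q')"
    using finite_transitions place_in_subset
    by (intro sum.mono_neutral_right) (auto simp: rescaled_process_def)
  also have "\<dots> = (\<Sum>q'\<in>place_in N p.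
      route N q p * inverse (wt_pt N q p) * (wt_tp N p q' * (e q' * w q')) / e q)"
    by (rule sum.cong) (auto simp: rescaled_process_def)
  finally show ?thesis
    by (simp add: sum_distrib_left sum_divide_distrib)
qed

lemma rescaled_prob_sum:
  assumes "positive_stoichiometric_invariant N e"
    and "q \<in> transitions N" "p \<in> trans_in N q"
  shows "(\<Sum>q'\<in>transitions N. transition_prob (rescaled_process N e) q p q') = 1"
proof -
  have "e q = route N q p * inverse (wt_pt N q p) * (\<Sum>q'\<in>place_in N p. wt_tp N p q' * e q')"
    and "0 < e q"
    using assms
    by (auto simp: positive_stoichiometric_invariant_def stoichiometric_invariant_def)
  then show ?thesis
    using rescaled_expectation[of e q p "\<lambda>_. 1"] by (metis (no_types, lifting) divide_self less_irrefl
        mult.right_neutral sum.cong)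
qed

lemma semi_markov_rescaled_process:
  assumes "positive_stoichiometric_invariant N e"
  shows "semi_markov_decision_process (rescaled_process N e)"
proof
  show "finite (states (rescaled_process N e))"
    by (simp add: rescaled_process_def finite_transitions)
next
  fix q assume "q \<in> states (rescaled_process N e)"
  then have q: "q \<in> transitions N" by (simp add: rescaled_process_def)
  show "finite (actions (rescaled_process N e) q)"
    by (simp add: rescaled_process_def finite_trans_in)
  show "actions (rescaled_process N e) q \<noteq> {}"
    using q by (simp add: rescaled_process_def trans_in_nonempty)
  fix p assume "p \<in> actions (rescaled_process N e) q"
  then have p: "p \<in> trans_in N q" by (simp add: rescaled_process_def)
  show "0 \<le> sojourn (rescaled_process N e) q p"
    using p trans_in_subset holding_nonneg by (auto simp: rescaled_process_def)
  show "0 \<le> discount (rescaled_process N e) q p"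
    by (simp add: rescaled_process_def)
  show "(\<Sum>q'\<in>states (rescaled_process N e). transition_prob (rescaled_process N e) q p q') = 1"
    using rescaled_prob_sum[OF assms q p] by (simp add: rescaled_process_def)
  fix q' assume "q' \<in> states (rescaled_process N e)"
  then have "0 < e q" "0 < e q'"
    using assms q by (auto simp: rescaled_process_def positive_stoichiometric_invariant_def)
  moreover have "q' \<in> place_in N p \<Longrightarrow> 0 < wt_tp N p q'"
    by (simp add: place_in_def wt_tp_pos)
  ultimately show "0 \<le> transition_prob (rescaled_process N e) q p q'"
    using positive_invariant_coeff_pos[OF assms q p]
    by (simp add: rescaled_process_def less_imp_le del: times_divide_eq_right)
qed

lemma rescaled_process_equivalent:
  assumes "positive_stoichiometric_invariant N e"
  shows "equivalent_dynamics e N (rescaled_process N e)"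
  unfolding equivalent_dynamics_def
proof (intro conjI allI impI)
  let ?D = "rescaled_process N e"
  show "states ?D = transitions N"
    by (simp add: rescaled_process_def)
  show e_pos: "\<forall>q\<in>transitions N. 0 < e q"
    using assms by (simp add: positive_stoichiometric_invariant_def)
  fix T :: "real set" and z v :: "'q \<Rightarrow> real \<Rightarrow> real"
  assume zv: "\<forall>q\<in>transitions N. \<forall>t. z q t = e q * v q t"
  have "z q t = (MIN p\<in>trans_in N q.
        route N q p * inverse (wt_pt N q p) *
        (marking N p + (\<Sum>q'\<in>place_in N p. wt_tp N p q' * z q' (t - holding N p)))) \<longleftrightarrow>
      v q t = (INF p\<in>actions ?D q. cost ?D q p +
        discount ?D q p * (\<Sum>q'\<in>states ?D. transition_prob ?D q p q' * v q' (t - sojourn ?D q p)))"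
    (is "z q t = (MIN p\<in>_. ?F p) \<longleftrightarrow> v q t = (INF p\<in>_. ?G p)")
    if q: "q \<in> transitions N" for q t
  proof -
    have eq: "0 < e q" using e_pos q by blast
    have FG: "?F p = e q * ?G p" for p
    proof -
      have "(\<Sum>q'\<in>place_in N p. wt_tp N p q' * z q' (t - holding N p)) =
          (\<Sum>q'\<in>place_in N p. wt_tp N p q' * (e q' * v q' (t - holding N p)))"
        using zv place_in_subset by (intro sum.cong) auto
      moreover have "?G p = route N q p * inverse (wt_pt N q p) * marking N p / e q +
          (\<Sum>q'\<in>transitions N. transition_prob ?D q p q' * v q' (t - holding N p))"
        by (simp add: rescaled_process_def)
      ultimately show ?thesis
        using eq by (simp add: rescaled_expectation distrib_left)
    qed
    have "(MIN p\<in>trans_in N q. ?F p) = e q * (MIN p\<in>trans_in N q. ?G p)"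
      unfolding FG
      using finite_trans_in trans_in_nonempty[OF q] eq by (intro Min_mult_left) auto
    also have "(MIN p\<in>trans_in N q. ?G p) = (INF p\<in>actions ?D q. ?G p)"
    proof -
      have "actions ?D q = trans_in N q" by (simp add: rescaled_process_def)
      then show ?thesis
        using finite_trans_in[of q] trans_in_nonempty[OF q] by (simp add: cInf_eq_Min)
    qed
    finally show ?thesis using zv q eq by simp
  qed
  then show "petri_dynamics N T z \<longleftrightarrow> dp_equation ?D T v"
    unfolding petri_dynamics_def dp_equation_def
    by (simp add: \<open>states ?D = transitions N\<close>)
qed

end

theorem mainTheorem2:
  fixes N :: "('p, 'q) petri_net" and e :: "'q \<Rightarrow> real"
  assumes "fluid_petri_net N"
    and "positive_stoichiometric_invariant N e"
  shows "\<exists>D :: ('q, 'p) decision_process.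
    semi_markov_decision_process D \<and> undiscounted D \<and> equivalent_dynamics e N D"
proof (intro exI conjI)
  interpret fluid_petri_net N by fact
  show "semi_markov_decision_process (rescaled_process N e)"
    by (rule semi_markov_rescaled_process) fact
  show "undiscounted (rescaled_process N e)"
    by (simp add: undiscounted_def rescaled_process_def)
  show "equivalent_dynamics e N (rescaled_process N e)"
    by (rule rescaled_process_equivalent) fact
qed

end
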